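(* Let $S$ be a numerical semigroup and let $t$ be a nonzero element of $S$. Let $\mathcal{A}_t := \mathrm{Ap}(S;t)$. Then \[ O(G(S))-E(G(S)) = -\frac{1}{2} + \begin{cases} \dfrac{E(\mathcal{A}_t)-O(\mathcal{A}_t)}{2} & \text{if } t \text{ is odd},\\[2mm] \dfrac{\sigma_O(\mathcal{A}_t)-\sigma_E(\mathcal{A}_t)}{t} & \text{if } t \text{ is even}.\end{cases} \]
   Context: $\mathbb{N}_0$ denotes the set of nonnegative integers. A numerical semigroup $S$ is a submonoid of $(\mathbb{N}_0,+)$ with finite complement; $G(S)=\mathbb{N}_0\setminus S$ is its (finite) set of gaps. For a nonzero $t\in S$, the Apéry set of $S$ relative to $t$ is $\mathrm{Ap}(S;t)=\{s\in S : s-t\notin S\}$; it is finite, with exactly $t$ elements. For a finite set $T$ of integers, $O(T)$ (resp. $E(T)$) is the number of odd (resp. even) integers in $T$, and $\sigma_O(T)$ (resp. $\sigma_E(T)$) is the sum of the odd (resp. even) elements of $T$. The identity is between rational numbers. *)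

theory Defs
  imports Complex_Main
begin

definition numerical_semigroup :: "nat set \<Rightarrow> bool" where
  "numerical_semigroup S \<longleftrightarrow>
     0 \<in> S \<and> (\<forall>x\<in>S. \<forall>y\<in>S. x + y \<in> S) \<and> finite (UNIV - S)"

definition gaps :: "nat set \<Rightarrow> nat set" where
  "gaps S = UNIV - S"

text \<open>The difference is taken in the integers, because truncated subtraction on the natural
  numbers would give \<open>s - t = 0 \<in> S\<close> for \<open>s < t\<close>, wrongly excluding such elements.\<close>

definition apery_set :: "nat set \<Rightarrow> nat \<Rightarrow> nat set" where
  "apery_set S t = {s \<in> S. int s - int t \<notin> int ` S}"

text \<open>The following four are meant for finite sets only (both \<open>card\<close> and \<open>sum\<close> are 0 on
  infinite sets).\<close>

definition odd_count :: "'a::semiring_parity set \<Rightarrow> nat" where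
  "odd_count T = card {x \<in> T. odd x}"

definition even_count :: "'a::semiring_parity set \<Rightarrow> nat" where
  "even_count T = card {x \<in> T. even x}"

definition odd_sum :: "'a::semiring_parity set \<Rightarrow> 'a" where
  "odd_sum T = (\<Sum>x\<in>{x \<in> T. odd x}. x)"

definition even_sum :: "'a::semiring_parity set \<Rightarrow> 'a" where
  "even_sum T = (\<Sum>x\<in>{x \<in> T. even x}. x)"

lemma mem_apery_set_iff: "s \<in> apery_set S t \<longleftrightarrow> s \<in> S \<and> (t \<le> s \<longrightarrow> s - t \<notin> S)"
proof (cases "t \<le> s")
  case True
  then have "int s - int t = int (s - t)" by (simp add: of_nat_diff)
  then have "int s - int t \<in> int ` S \<longleftrightarrow> s - t \<in> S"
    by (metis image_iff of_nat_eq_iff)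
  then show ?thesis using True unfolding apery_set_def by blast
next
  case False
  then show ?thesis by (auto simp: apery_set_def)
qed

lemma finite_gaps: "numerical_semigroup S \<Longrightarrow> finite (gaps S)"
  by (simp add: numerical_semigroup_def gaps_def)

lemma finite_apery_set:
  assumes "numerical_semigroup S"
  shows "finite (apery_set S t)"
proof (rule finite_subset)
  show "apery_set S t \<subseteq> {..<t} \<union> (\<lambda>x. x + t) ` gaps S"
  proof
    fix s assume s: "s \<in> apery_set S t"
    show "s \<in> {..<t} \<union> (\<lambda>x. x + t) ` gaps S"
    proof (cases "t \<le> s")
      case True
      then have "s - t \<in> gaps S" "s = (s - t) + t"
        using s by (auto simp: mem_apery_set_iff gaps_def)
      then show ?thesis by blast
    qed simp
  qed
qed (use finite_gaps[OF assms] in simp)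

end

(* The disjoint unions of Ap(S;t) with G(S), and of {0,...,t-1} with t + G(S), coincide: both
   consist of the n for which n - t is negative or a gap. Hence, for every function f, the
   sum of f(g + t) - f(g) over the gaps equals the sum of f over Ap(S;t) minus its sum over
   {0,...,t-1}. Take f(n) = (-1)^n for odd t and f(n) = (-1)^n n for even t. *)

theory Submission
  imports Defs
begin

lemma apery_set_Un_gaps:
  assumes "numerical_semigroup S" "t \<in> S"
  shows "apery_set S t \<union> gaps S = {..<t} \<union> (\<lambda>g. g + t) ` gaps S"
proof (rule set_eqI)
  fix n
  show "n \<in> apery_set S t \<union> gaps S \<longleftrightarrow> n \<in> {..<t} \<union> (\<lambda>g. g + t) ` gaps S"
  proof (cases "n < t")
    case True
    then show ?thesis by (auto simp: mem_apery_set_iff gaps_def)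
  next
    case False
    then obtain m where m: "n = m + t"
      by (metis add.commute le_iff_add not_less)
    \<comment> \<open>Closure under adding \<open>t\<close> rules out the one remaining case: if
      \<open>n - t\<close> lies in \<open>S\<close>, then so does \<open>n\<close>, hence
      \<open>n\<close> is neither an Apery element nor a gap.\<close>
    have "m \<in> S \<Longrightarrow> m + t \<in> S"
      using assms by (simp add: numerical_semigroup_def)
    then show ?thesis
      unfolding m by (auto simp: mem_apery_set_iff gaps_def)
  qed
qed

lemma sum_gaps_diff:
  fixes f :: "nat \<Rightarrow> 'a::ab_group_add"
  assumes S: "numerical_semigroup S" and t: "t \<in> S"
  shows "(\<Sum>g\<in>gaps S. f (g + t) - f g) = sum f (apery_set S t) - sum f {..<t}"
proof -
  have "sum f (apery_set S t) + sum f (gaps S) = sum f (apery_set S t \<union> gaps S)"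
    using finite_apery_set[OF S] finite_gaps[OF S]
    by (intro sum.union_disjoint[symmetric]) (auto simp: apery_set_def gaps_def)
  also have "\<dots> = sum f {..<t} + sum f ((\<lambda>g. g + t) ` gaps S)"
    unfolding apery_set_Un_gaps[OF S t]
    by (intro sum.union_disjoint) (auto simp: finite_gaps[OF S])
  also have "sum f ((\<lambda>g. g + t) ` gaps S) = (\<Sum>g\<in>gaps S. f (g + t))"
    by (simp add: sum.reindex inj_on_def)
  finally show ?thesis
    by (simp add: sum_subtractf algebra_simps)
qed

text \<open>Common source of the two parity formulas below: \<open>f = 1\<close> yields the counts
  and \<open>f = of_nat\<close> the sums.\<close>

lemma sum_alternating:
  fixes f :: "nat \<Rightarrow> 'a::comm_ring_1"
  assumes "finite T"
  shows "(\<Sum>n\<in>T. (-1) ^ n * f n) = sum f {n \<in> T. even n} - sum f {n \<in> T. odd n}"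
proof -
  have "(\<Sum>n\<in>T. (-1) ^ n * f n)
      = (\<Sum>n\<in>T. (if even n then f n else 0) - (if odd n then f n else 0))"
    by (rule sum.cong) auto
  then show ?thesis
    using assms by (simp add: sum_subtractf sum.inter_filter)
qed

lemma sum_minus_one_power:
  assumes "finite T"
  shows "(\<Sum>n\<in>T. (-1) ^ n) = (of_nat (even_count T) - of_nat (odd_count T) :: 'a::comm_ring_1)"
  using sum_alternating[OF assms, of "\<lambda>_. 1 :: 'a"]
  by (simp add: even_count_def odd_count_def)

lemma sum_minus_one_power_times:
  assumes "finite T"
  shows "(\<Sum>n\<in>T. (-1) ^ n * of_nat n) = (of_nat (even_sum T) - of_nat (odd_sum T) :: 'a::comm_ring_1)"
  using sum_alternating[OF assms, of "of_nat :: nat \<Rightarrow> 'a"]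
  by (simp add: even_sum_def odd_sum_def)

lemma sum_minus_one_power_lessThan:
  "(\<Sum>i<t. (-1) ^ i) = (if odd t then 1 else 0 :: 'a::comm_ring_1)"
  by (induction t) auto

text \<open>Each of the \<open>k\<close> pairs \<open>2 * j\<close>, \<open>2 * j + 1\<close>
  contributes -1.\<close>

lemma sum_minus_one_power_times_lessThan_even:
  "(\<Sum>i<2 * k. (-1) ^ i * of_nat i) = (- of_nat k :: 'a::comm_ring_1)"
  by (induction k) auto

theorem proposition2p3:
  fixes S :: "nat set" and t :: nat
  assumes "numerical_semigroup S" and "t \<in> S" and "t \<noteq> 0"
  shows "(of_nat (odd_count (gaps S)) - of_nat (even_count (gaps S)) :: rat) =
    - (1 / 2) +
    (if odd t
     then (of_nat (even_count (apery_set S t)) - of_nat (odd_count (apery_set S t))) / 2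
     else (of_nat (odd_sum (apery_set S t)) - of_nat (even_sum (apery_set S t))) / of_nat t)"
proof -
  note fin = finite_gaps[OF assms(1)] finite_apery_set[OF assms(1)]
  \<comment> \<open>The sign \<open>(-1) ^ g\<close> counts even gaps positively, so
    \<open>D\<close> is the negative of the left-hand side of the claim.\<close>
  define D :: rat where "D = of_nat (even_count (gaps S)) - of_nat (odd_count (gaps S))"
  have D: "(\<Sum>g\<in>gaps S. (-1) ^ g) = D"
    unfolding D_def by (rule sum_minus_one_power[OF fin(1)])
  show ?thesis
  proof (cases "odd t")
    case True
    \<comment> \<open>A shift by an odd \<open>t\<close> flips the sign, so each term is
      \<open>-2 * (-1) ^ g\<close>.\<close>
    have "(\<Sum>g\<in>gaps S. (-1) ^ (g + t) - (-1) ^ g) = - 2 * D"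
      unfolding D[symmetric] sum_distrib_left using True by (intro sum.cong) (auto simp: power_add)
    \<comment> \<open>The final 1 is the alternating sum over \<open>{..<t}\<close>; division by 2
      turns it into the constant -1/2.\<close>
    then have "- 2 * D = of_nat (even_count (apery_set S t)) - of_nat (odd_count (apery_set S t)) - 1"
      using True sum_gaps_diff[OF assms(1,2), of "\<lambda>n. (-1) ^ n :: rat"]
      by (simp add: sum_minus_one_power[OF fin(2)] sum_minus_one_power_lessThan)
    then show ?thesis
      using True unfolding D_def by (simp add: field_simps)
  next
    case False
    then obtain k where k: "t = 2 * k" by auto
    \<comment> \<open>A shift by an even \<open>t\<close> keeps the sign, so the weights
      \<open>g\<close> cancel and each term is \<open>t * (-1) ^ g\<close>.\<close>
    have "(\<Sum>g\<in>gaps S. (-1) ^ (g + t) * of_nat (g + t) - (-1) ^ g * of_nat g) = of_nat t * D"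
      unfolding D[symmetric] sum_distrib_left using False
      by (intro sum.cong) (auto simp: power_add algebra_simps)
    \<comment> \<open>The sum over \<open>{..<t}\<close> is \<open>-k\<close>, that is
      \<open>-t / 2\<close>; subtracting it gives the last term, and dividing by \<open>-t\<close>
      makes this term -1/2.\<close>
    then have "of_nat t * D
        = of_nat (even_sum (apery_set S t)) - of_nat (odd_sum (apery_set S t)) + of_nat t / 2"
      using sum_gaps_diff[OF assms(1,2), of "\<lambda>n. (-1) ^ n * of_nat n :: rat"]
        sum_minus_one_power_times_lessThan_even[of k, where 'a = rat]
      by (simp add: sum_minus_one_power_times[OF fin(2)] k)
    then show ?thesis
      using False assms(3) unfolding D_def by (simp add: field_simps)
  qed
qed

end
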